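(* Let $f$ satisfy Assumption B (see context), let $m\ge1$ and let $$x_{\max}=a_m<a_{m-1}<\dots<a_1<a_0:=K .$$ Let $L_i^-,L_i^+>0$, $i=0,\dots,m-1$, with $L_0^-L_0^+>1$, and put $$\alpha_0:=\frac{L_0^-L_0^+-1}{(L_0^-+1)(L_0^++1)},\qquad \mathcal L_i^{\pm}(\alpha):=L_i^{\pm}-\alpha(L_i^{\pm}+1),\quad i=0,\dots,m-1.$$ Assume $\mathcal L_i^-(\alpha_0)>0$ for $i=0,\dots,m-1$, and define $$b_0:=K,\qquad b_i:=\mathcal L_{i-1}^-(\alpha_0)\,(a_{i-1}-a_i)+b_{i-1},\quad i=1,\dots,m.$$ Suppose that $$f(x)-K\le L_0^-(K-x)\ \text{ for } a_1\le x\le K,\qquad K-f(x)\le L_0^+(x-K)\ \text{ for } x>K,$$ and, for $i=1,\dots,m-1$, $$f(x)-f(a_i)\le L_i^-(a_i-x)\ \text{ for } a_{i+1}\le x\le a_i,\qquad f(b_i)-f(x)\le L_i^+(x-b_i)\ \text{ for } x\ge b_i,$$ and that $$\alpha_0\ge\frac{L_i^-L_i^+-1}{(L_i^-+1)(L_i^++1)}\qquad\text{for } i=1,\dots,m-1 .$$ Then for every $\alpha\in(\alpha_0,1)$ and every $x_0>0$ the solution of $$x_{n+1}=(1-\alpha)f(x_n)+\alpha x_n,\qquad n=0,1,2,\dots,$$ satisfies $\lim_{n\to\infty}x_n=K$.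
   Context: Assumption A on $f$: $f:[0,\infty)\to[0,\infty)$ is continuous, $f(0)=0$, $f$ has exactly one positive equilibrium (fixed point) $K>0$, which is locally unstable (not Lyapunov stable) for $x_{n+1}=f(x_n)$; $f(x)>x$ for $x\in(0,K)$ and $0<f(x)<x$ for $x\in(K,\infty)$. Notation: $f_m:=\max_{x\in[0,K]}f(x)$; $x_{\max}$ is the largest point of $[0,K]$ at which this maximum is attained. One has $K<f_m$. Assumption B on $f$: Assumption A holds and for some constants $L^-\ge L^+>1$, $f(x)-K\le L^-(K-x)$ for $x\in(x_{\max},K)$ and $K-f(x)\le L^+(x-K)$ for $x\in(K,f_m)$. *)

theory Defs
  imports "HOL-Analysis.Analysis"
begin

(* A map [0,oo) -> [0,oo) is a function on real of which only the values on {0..} matter. *)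

definition lyapunov_stable :: "(real \<Rightarrow> real) \<Rightarrow> real \<Rightarrow> bool" where
  "lyapunov_stable f K \<longleftrightarrow>
     (\<forall>\<epsilon>>0. \<exists>\<delta>>0. \<forall>y\<ge>0. \<bar>y - K\<bar> < \<delta> \<longrightarrow> (\<forall>n. \<bar>(f ^^ n) y - K\<bar> < \<epsilon>))"

definition assumption_A :: "(real \<Rightarrow> real) \<Rightarrow> real \<Rightarrow> bool" where
  "assumption_A f K \<longleftrightarrow>
     continuous_on {0..} f \<and> (\<forall>x\<ge>0. f x \<ge> 0) \<and> f 0 = 0 \<and>
     K > 0 \<and> f K = K \<and> (\<forall>x>0. f x = x \<longrightarrow> x = K) \<and>
     \<not> lyapunov_stable f K \<and>
     (\<forall>x\<in>{0<..<K}. f x > x) \<and> (\<forall>x>K. 0 < f x \<and> f x < x)"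

definition f_max :: "(real \<Rightarrow> real) \<Rightarrow> real \<Rightarrow> real" where
  "f_max f K = (SUP x\<in>{0..K}. f x)"

definition x_max :: "(real \<Rightarrow> real) \<Rightarrow> real \<Rightarrow> real" where
  "x_max f K = (GREATEST x. x \<in> {0..K} \<and> f x = f_max f K)"

(* Under assumption_A the supremum is a maximum and the greatest maximizer exists. *)
lemma x_max_attains:
  assumes "assumption_A f K"
  shows "x_max f K \<in> {0..K}" "f (x_max f K) = f_max f K"
    and "\<And>x. x \<in> {0..K} \<Longrightarrow> f x \<le> f_max f K"
    and "\<And>x. x \<in> {0..K} \<Longrightarrow> f x = f_max f K \<Longrightarrow> x \<le> x_max f K"
proof -
  have K: "K > 0" and c0: "continuous_on {0..} f"
    using assms unfolding assumption_A_def by blast+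
  have c: "continuous_on {0..K} f"
    by (rule continuous_on_subset[OF c0]) simp
  have ne: "{0..K} \<noteq> {}" using K by simp
  obtain z where z: "z \<in> {0..K}" "\<And>y. y \<in> {0..K} \<Longrightarrow> f y \<le> f z"
    using continuous_attains_sup[OF compact_Icc ne c] by blast
  have m: "f_max f K = f z"
    unfolding f_max_def
    by (rule cSup_eq_maximum[OF imageI[OF z(1)]], erule imageE, simp only: z(2))
  show ub: "f x \<le> f_max f K" if "x \<in> {0..K}" for x
    unfolding m using z(2)[OF that] .
  define S where "S = {x \<in> {0..K}. f x = f_max f K}"
  have "closed S"
    unfolding S_def by (rule continuous_closed_preimage_constant[OF c closed_atLeastAtMost])
  moreover have "bounded S"
    by (rule bounded_subset[OF bounded_closed_interval[of 0 K]]) (unfold S_def, blast)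
  ultimately have S: "compact S"
    by (simp only: compact_eq_bounded_closed)
  have "z \<in> S"
    unfolding S_def by (rule CollectI, rule conjI[OF z(1) m[symmetric]])
  then have "S \<noteq> {}" by (metis empty_iff)
  with S have "\<exists>s\<in>S. \<forall>t\<in>S. t \<le> s"
    by (rule compact_attains_sup)
  then obtain s where s: "s \<in> S" "\<And>t. t \<in> S \<Longrightarrow> t \<le> s"
    by blast
  have "x_max f K = s"
    unfolding x_max_def
  proof (rule Greatest_equality)
    show "s \<in> {0..K} \<and> f s = f_max f K" using s(1) unfolding S_def by blast
    show "y \<le> s" if "y \<in> {0..K} \<and> f y = f_max f K" for y
      by (rule s(2)) (use that in \<open>unfold S_def, blast\<close>)
  qed
  note x = s[folded this]
  show "x_max f K \<in> {0..K}" "f (x_max f K) = f_max f K"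
    using x(1) unfolding S_def by blast+
  show "y \<le> x_max f K" if "y \<in> {0..K}" "f y = f_max f K" for y
    by (rule x(2)) (use that in \<open>unfold S_def, blast\<close>)
qed

definition assumption_B :: "(real \<Rightarrow> real) \<Rightarrow> real \<Rightarrow> bool" where
  "assumption_B f K \<longleftrightarrow>
     assumption_A f K \<and>
     (\<exists>Lm Lp. Lm \<ge> Lp \<and> Lp > 1 \<and>
        (\<forall>x\<in>{x_max f K<..<K}. f x - K \<le> Lm * (K - x)) \<and>
        (\<forall>x\<in>{K<..<f_max f K}. K - f x \<le> Lp * (x - K)))"

definition alpha_crit :: "real \<Rightarrow> real \<Rightarrow> real" where
  "alpha_crit Lm Lp = (Lm * Lp - 1) / ((Lm + 1) * (Lp + 1))"

(* One-sided slope bound of (1 - \<alpha>) f(x) + \<alpha> x when L is that of f. *)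
definition scaled_slope :: "real \<Rightarrow> real \<Rightarrow> real" where
  "scaled_slope L \<alpha> = L - \<alpha> * (L + 1)"

primrec b_seq :: "real \<Rightarrow> real \<Rightarrow> (nat \<Rightarrow> real) \<Rightarrow> (nat \<Rightarrow> real) \<Rightarrow> nat \<Rightarrow> real" where
  "b_seq K \<alpha>0 Lm a 0 = K"
| "b_seq K \<alpha>0 Lm a (Suc i) = scaled_slope (Lm i) \<alpha>0 * (a i - a (Suc i)) + b_seq K \<alpha>0 Lm a i"

end

theory Submission imports Defs begin

text \<open>
  Write \<open>g\<close> for the averaged map with weight \<open>\<alpha>\<close> and \<open>h\<close> for the one with weight \<open>\<alpha>0\<close>.
  An orbit of \<open>g\<close> that starts at a positive point stays in a compact subinterval of the positive
  half-line, so its inferior and superior limits \<open>l \<le> u\<close> are images \<open>l = g q\<close>, \<open>u = g p\<close> of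
  points \<open>p, q\<close> of \<open>{l..u}\<close> (\<open>bounded_orbit_extreme_limits\<close>). Points above \<open>K\<close> are moved down
  and points below \<open>K\<close> are moved up, so unless \<open>l = u = K\<close> this forces \<open>p < K < q\<close>, that is
  \<open>g q \<le> p < K < q \<le> g p\<close>: a point below \<open>K\<close> and one above it that overshoot each other. It
  remains to exclude such a pair.

  The hypotheses on the slopes of \<open>f\<close> do so. In terms of \<open>h\<close> they imply that, between
  \<open>x_max f K\<close> and \<open>K\<close>, the graph of \<open>h\<close> lies on or below the decreasing polygonal line \<open>\<phi>\<close>
  through the points \<open>(a i, b i)\<close>; to the left of \<open>x_max f K\<close> the values of \<open>h\<close> are at most the
  one at that point. Since \<open>\<alpha>0\<close> is at least every critical weight, the product of the two slope bounds
  on each piece is at most 1 (\<open>scaled_slope_product_le_1\<close>), and so, on \<open>{K..b m}\<close>, the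
  graph of \<open>h\<close> lies on or above the inverse of \<open>\<phi>\<close>. Hence \<open>h q < p\<close> and \<open>q < h p\<close> cannot both hold
  (\<open>staircase_no_overshoot\<close>). Passing from \<open>\<alpha>0\<close> to the larger weight \<open>\<alpha>\<close> moves the image of
  every positive point other than \<open>K\<close> strictly towards that point, so \<open>g p < h p\<close> and \<open>h q < g q\<close>, and
  the pair above would give \<open>h q < p\<close> and \<open>q < h p\<close>.
\<close>

section \<open>Averaged maps and their slope bounds\<close>

definition averaged :: "real \<Rightarrow> (real \<Rightarrow> real) \<Rightarrow> real \<Rightarrow> real" where
  "averaged \<beta> f y = (1 - \<beta>) * f y + \<beta> * y"

text \<open>
  For \<open>y \<le> z\<close> this bounds the fall from \<open>y\<close> to \<open>z\<close>. It is used with \<open>z\<close> held fixed, as an upper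
  bound to the left of \<open>z\<close>, and with \<open>y\<close> held fixed, as a lower bound to the right of \<open>y\<close>.
\<close>
lemma averaged_slope:
  assumes "\<beta> \<le> 1" "f y - f z \<le> L * (z - y)"
  shows "averaged \<beta> f y - averaged \<beta> f z \<le> scaled_slope L \<beta> * (z - y)"
proof -
  have "(1 - \<beta>) * (f y - f z) \<le> (1 - \<beta>) * (L * (z - y))"
    using assms by (intro mult_left_mono) auto
  then show ?thesis
    unfolding averaged_def scaled_slope_def by (simp add: algebra_simps)
qed

lemma averaged_less_iff:
  assumes "\<beta> < \<gamma>"
  shows "averaged \<gamma> f y < averaged \<beta> f y \<longleftrightarrow> y < f y"
    and "averaged \<beta> f y < averaged \<gamma> f y \<longleftrightarrow> f y < y"
proof -
  have eq: "averaged \<beta> f y - averaged \<gamma> f y = (\<gamma> - \<beta>) * (f y - y)"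
    unfolding averaged_def by (simp add: algebra_simps)
  have "averaged \<gamma> f y < averaged \<beta> f y \<longleftrightarrow> 0 < (\<gamma> - \<beta>) * (f y - y)"
    unfolding eq[symmetric] by simp
  then show "averaged \<gamma> f y < averaged \<beta> f y \<longleftrightarrow> y < f y"
    using assms by (simp add: zero_less_mult_iff)
  have "averaged \<beta> f y < averaged \<gamma> f y \<longleftrightarrow> (\<gamma> - \<beta>) * (f y - y) < 0"
    unfolding eq[symmetric] by simp
  then show "averaged \<beta> f y < averaged \<gamma> f y \<longleftrightarrow> f y < y"
    using assms by (simp add: mult_less_0_iff)
qed

text \<open>
  At the critical weight the two scaled slopes are \<open>(A + 1) / (B + 1)\<close> and its reciprocal; both
  decrease with the weight. The second may have become negative, so it is estimated first, with the
  positive one as factor.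
\<close>
lemma scaled_slope_product_le_1:
  assumes A: "A > 0" and B: "B > 0" and crit: "alpha_crit A B \<le> \<beta>"
    and pos: "scaled_slope A \<beta> > 0"
  shows "scaled_slope A \<beta> * scaled_slope B \<beta> \<le> 1"
proof -
  let ?c = "alpha_crit A B"
  have at_crit: "scaled_slope A ?c = (A + 1) / (B + 1)" "scaled_slope B ?c = (B + 1) / (A + 1)"
    using A B unfolding scaled_slope_def alpha_crit_def
    by (simp_all add: divide_simps) (simp_all add: algebra_simps)
  have mono: "scaled_slope L \<beta> \<le> scaled_slope L ?c" if "L > 0" for L
    unfolding scaled_slope_def using crit that by (simp add: mult_right_mono)
  have "scaled_slope A \<beta> * scaled_slope B \<beta> \<le> scaled_slope A \<beta> * ((B + 1) / (A + 1))"
    using mono[OF B] pos by (intro mult_left_mono) (auto simp: at_crit)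
  also have "\<dots> \<le> (A + 1) / (B + 1) * ((B + 1) / (A + 1))"
    using mono[OF A] A B by (intro mult_right_mono) (auto simp: at_crit)
  also have "\<dots> = 1"
    using A B by simp
  finally show ?thesis .
qed

section \<open>The polygonal barrier\<close>

lemma ex_grid_interval:
  fixes a :: "nat \<Rightarrow> real"
  assumes "a m \<le> y" "y < a 0"
  shows "\<exists>i<m. a (Suc i) \<le> y \<and> y < a i"
  using assms(1)
proof (induction m)
  case 0
  then show ?case using assms(2) by simp
next
  case (Suc m)
  then show ?case by (cases "a m \<le> y") (auto intro: less_SucI)
qed

text \<open>
  The polygonal line through the points \<open>(a i, b i)\<close> bounds \<open>h\<close> from above on \<open>{a m..a 0}\<close>, and
  its inverse bounds \<open>h\<close> from below on \<open>{b 0..b m}\<close>. The assumed bound to the right of \<open>b i\<close> is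
  relative to \<open>h (b i)\<close>; that this value is at least \<open>a i\<close> follows by induction along the grid.
\<close>
locale polygonal_barrier =
  fixes a b s t :: "nat \<Rightarrow> real" and h :: "real \<Rightarrow> real" and m :: nat
  assumes a_dec: "\<And>i. i < m \<Longrightarrow> a (Suc i) < a i"
    and s_pos: "\<And>i. i < m \<Longrightarrow> s i > 0"
    and st: "\<And>i. i < m \<Longrightarrow> s i * t i \<le> 1"
    and b_Suc: "\<And>i. i < m \<Longrightarrow> b (Suc i) = s i * (a i - a (Suc i)) + b i"
    and h_left: "\<And>i y. i < m \<Longrightarrow> a (Suc i) \<le> y \<Longrightarrow> y \<le> a i \<Longrightarrow> h y - h (a i) \<le> s i * (a i - y)"
    and h_right: "\<And>i y. i < m \<Longrightarrow> b i \<le> y \<Longrightarrow> h (b i) - h y \<le> t i * (y - b i)"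
    and h_a0: "h (a 0) \<le> b 0" and h_b0: "a 0 \<le> h (b 0)"
begin

lemma grid_b_inc: "i < m \<Longrightarrow> b i < b (Suc i)"
  using b_Suc s_pos a_dec by simp

lemma grid_b_mono: "i \<le> j \<Longrightarrow> j \<le> m \<Longrightarrow> b i \<le> b j"
proof (induction j rule: dec_induct)
  case (step n)
  then show ?case using grid_b_inc[of n] by simp
qed simp

lemma h_grid_a: "i \<le> m \<Longrightarrow> h (a i) \<le> b i"
proof (induction i)
  case 0
  then show ?case using h_a0 by simp
next
  case (Suc i)
  then show ?case using h_left[of i "a (Suc i)"] a_dec[of i] b_Suc[of i] by simp
qed

lemma h_left_bound:
  assumes "i < m" "a (Suc i) \<le> y" "y \<le> a i"
  shows "h y \<le> b i + s i * (a i - y)"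
  using h_left[OF assms] h_grid_a[of i] assms(1) by simp

lemma h_left_le_b:
  assumes "i < m" "a (Suc i) \<le> y" "y \<le> a i"
  shows "h y \<le> b (Suc i)"
proof -
  have "s i * (a i - y) \<le> s i * (a i - a (Suc i))"
    using assms s_pos[of i] by (intro mult_left_mono) auto
  then show ?thesis
    using h_left_bound[OF assms] b_Suc[OF assms(1)] by simp
qed

lemma h_le_last_b:
  assumes "a m \<le> y" "y < a 0"
  shows "h y \<le> b m"
proof -
  obtain i where "i < m" "a (Suc i) \<le> y" "y < a i"
    using ex_grid_interval[of a m y] assms by blast
  then show ?thesis
    using h_left_le_b[of i y] grid_b_mono[of "Suc i" m] by simp
qed

text \<open>
  This is the step that uses \<open>s i * t i \<le> 1\<close>: the line of slope \<open>- t i\<close> through \<open>(b i, a i)\<close> does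
  not fall below the height \<open>w\<close> up to the abscissa \<open>b i + s i * (a i - w)\<close>, which is the value at
  \<open>w\<close> of the line of slope \<open>- s i\<close> through \<open>(a i, b i)\<close>.
\<close>
lemma slope_inverse_bound:
  assumes "i < m" "w \<le> a i" "b i \<le> y" "y \<le> b i + s i * (a i - w)"
  shows "w \<le> a i - t i * (y - b i)"
proof (cases "t i \<le> 0")
  case True
  then have "t i * (y - b i) \<le> 0"
    using assms(3) by (simp add: mult_nonpos_nonneg)
  then show ?thesis using assms(2) by simp
next
  case False
  then have "t i * (y - b i) \<le> t i * (s i * (a i - w))"
    using assms(4) by (intro mult_left_mono) auto
  also have "\<dots> = (s i * t i) * (a i - w)"
    by simp
  also have "\<dots> \<le> 1 * (a i - w)"
    using st[OF assms(1)] assms(2) by (intro mult_right_mono) auto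
  finally show ?thesis by simp
qed

lemma h_grid_b: "i \<le> m \<Longrightarrow> a i \<le> h (b i)"
proof (induction i)
  case 0
  then show ?case using h_b0 by simp
next
  case (Suc i)
  then have i: "i < m" by simp
  have "a (Suc i) \<le> a i - t i * (b (Suc i) - b i)"
    using i a_dec[OF i] grid_b_inc[OF i] b_Suc[OF i]
    by (intro slope_inverse_bound) auto
  then show ?case
    using h_right[OF i, of "b (Suc i)"] grid_b_inc[OF i] Suc by simp
qed

lemma h_right_bound:
  assumes "i < m" "w \<le> a i" "b i \<le> y" "y \<le> b i + s i * (a i - w)"
  shows "w \<le> h y"
  using slope_inverse_bound[OF assms] h_right[OF assms(1,3)] h_grid_b[of i] assms(1) by simp

text \<open>
  The two points must lie over the same piece of the polygonal line: \<open>p\<close> cannot lie to the left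
  of the piece whose heights include \<open>q\<close>, since \<open>p\<close> exceeds \<open>h q\<close>, which is at least the left end,
  nor to the right of it, since otherwise \<open>h p\<close> would not even reach the heights of that piece. Over a
  common piece the two linear bounds contradict each other.
\<close>
lemma staircase_no_overshoot:
  assumes p: "p < a 0" and q: "b 0 < q" "q \<le> b m" and hq: "h q < p"
  shows "h p \<le> q"
proof (rule ccontr)
  assume "\<not> h p \<le> q"
  then have hp: "q < h p" by simp
  obtain j where j: "j < m" "b j < q" "q \<le> b (Suc j)"
    using ex_grid_interval[of "\<lambda>i. - b i" m "- q"] q by auto
  have "a (Suc j) \<le> h q"
    using j a_dec[of j] b_Suc[of j] by (intro h_right_bound[of j]) auto
  then have pj: "a (Suc j) < p"
    using hq by simp
  then obtain i where i: "i < Suc j" "a (Suc i) \<le> p" "p < a i"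
    using ex_grid_interval[of a "Suc j" p] p by auto
  have "h p \<le> b (Suc i)"
    using i j by (intro h_left_le_b) auto
  then have "b j < b (Suc i)"
    using hp j by simp
  then have "i = j"
    using grid_b_mono[of "Suc i" j] i(1) j(1) by (cases "i < j") auto
  then have "q \<le> b j + s j * (a j - p)"
    using hp h_left_bound[of i p] i j(1) by simp
  then have "p \<le> h q"
    using \<open>i = j\<close> i j by (intro h_right_bound[of j]) auto
  then show False using hq by simp
qed

end

section \<open>Extreme limit points of a bounded orbit\<close>

lemma orbit_limit_has_preimage:
  fixes x :: "nat \<Rightarrow> real"
  assumes cont: "continuous_on C g" and C: "compact C" and x: "\<And>n. x n \<in> C"
    and orb: "\<And>n. x (Suc n) = g (x n)"
    and r: "strict_mono r" "(x \<circ> r) \<longlonglongrightarrow> z"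
  shows "\<exists>p\<in>C. \<exists>r'. strict_mono r' \<and> (x \<circ> r') \<longlonglongrightarrow> p \<and> g p = z"
proof -
  \<comment> \<open>\<open>r (Suc n)\<close> is positive, so that its predecessor is again an index of the orbit.\<close>
  define d where "d n = r (Suc n) - 1" for n
  have Suc_d: "Suc (d n) = r (Suc n)" for n
    using seq_suble[OF r(1), of "Suc n"] by (simp add: d_def)
  have d: "strict_mono d"
    unfolding strict_mono_Suc_iff
  proof
    fix n
    have "Suc (d n) < Suc (d (Suc n))"
      unfolding Suc_d using r(1) by (simp add: strict_mono_Suc_iff)
    then show "d n < d (Suc n)" by simp
  qed
  have "\<forall>n. (x \<circ> d) n \<in> C" using x by simp
  then obtain p k where pk: "p \<in> C" "strict_mono k" "((x \<circ> d) \<circ> k) \<longlonglongrightarrow> p"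
    using C unfolding compact_def by metis
  have "(\<lambda>n. g (((x \<circ> d) \<circ> k) n)) \<longlonglongrightarrow> g p"
    using continuous_on_tendsto_compose[OF cont pk(3) pk(1)] x by simp
  moreover have "(\<lambda>n. g (((x \<circ> d) \<circ> k) n)) = (x \<circ> r) \<circ> (\<lambda>n. Suc (k n))"
    by (rule ext) (simp add: orb[symmetric] Suc_d)
  moreover have "((x \<circ> r) \<circ> (\<lambda>n. Suc (k n))) \<longlonglongrightarrow> z"
    using r(2) pk(2) by (intro LIMSEQ_subseq_LIMSEQ[of "x \<circ> r"]) (auto simp: strict_mono_def)
  ultimately have "g p = z"
    using LIMSEQ_unique by metis
  moreover have "strict_mono (d \<circ> k)"
    using d pk(2) by (rule strict_mono_o)
  ultimately show ?thesis
    using pk by (auto simp: o_assoc intro!: bexI[of _ p] exI[of _ "d \<circ> k"])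
qed

text \<open>
  The extreme limit points exist as \<open>liminf\<close> and \<open>limsup\<close> in the extended reals. Both are
  subsequential limits, so each has a preimage that is itself a subsequential limit.
\<close>
lemma bounded_orbit_extreme_limits:
  fixes x :: "nat \<Rightarrow> real"
  assumes cont: "continuous_on {c..M} g" and x: "\<And>n. x n \<in> {c..M}"
    and orb: "\<And>n. x (Suc n) = g (x n)"
  obtains l u p q where "c \<le> l" "u \<le> M" "p \<in> {l..u}" "q \<in> {l..u}" "g p = u" "g q = l"
    "\<And>z. l = z \<Longrightarrow> u = z \<Longrightarrow> x \<longlonglongrightarrow> z"
proof -
  let ?X = "\<lambda>n. ereal (x n)"
  have lo: "ereal c \<le> liminf ?X"
    using x by (intro Liminf_bounded always_eventually) simp
  have hi: "limsup ?X \<le> ereal M"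
    using x by (intro Limsup_bounded always_eventually) simp
  have lu: "liminf ?X \<le> limsup ?X"
    by (rule Liminf_le_Limsup) simp
  obtain l where l: "liminf ?X = ereal l"
    using lo hi lu by (cases "liminf ?X") auto
  obtain u where u: "limsup ?X = ereal u"
    using lo hi lu by (cases "limsup ?X") auto
  have between: "z \<in> {l..u}" if "strict_mono r" "(x \<circ> r) \<longlonglongrightarrow> z" for r z
  proof -
    have "((?X \<circ> r) \<longlongrightarrow> ereal z) sequentially"
      using that(2) by (simp add: o_def)
    then have "liminf (?X \<circ> r) = ereal z" "limsup (?X \<circ> r) = ereal z"
      by (simp_all add: lim_imp_Liminf lim_imp_Limsup)
    then show ?thesis
      using liminf_subseq_mono[OF that(1), of ?X] limsup_subseq_mono[OF that(1), of ?X] l u by simp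
  qed
  have subseq: "\<exists>p\<in>{l..u}. g p = z" if "strict_mono r" "((?X \<circ> r) \<longlongrightarrow> ereal z) sequentially" for r z
  proof -
    have "(x \<circ> r) \<longlonglongrightarrow> z"
      using that(2) by (simp add: o_def)
    then show ?thesis
      using orbit_limit_has_preimage[where C="{c..M}" and g=g and x=x and r=r and z=z] cont x orb that(1) between
      by (metis compact_Icc)
  qed
  obtain p where p: "p \<in> {l..u}" "g p = u"
    using limsup_subseq_lim[of ?X] subseq u by metis
  obtain q where q: "q \<in> {l..u}" "g q = l"
    using liminf_subseq_lim[of ?X] subseq l by metis
  have "x \<longlonglongrightarrow> z" if "l = z" "u = z" for z
  proof -
    have "(?X \<longlongrightarrow> ereal z) sequentially"
      using l u that by (intro Liminf_eq_Limsup) simp_all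
    then show ?thesis by simp
  qed
  then show ?thesis
    using that[of l u p q] lo hi l u p q by simp
qed

section \<open>Global convergence\<close>

text \<open>
  Overshoot is the only obstruction: for a map that moves points towards \<open>K\<close> from either side,
  the extreme limit points of a nonconvergent orbit yield an overshooting pair. The positive
  lower bound in the proof keeps 0, which may be a second fixed point, out of
  the limit set.
\<close>
lemma converges_if_no_overshoot:
  fixes x :: "nat \<Rightarrow> real"
  assumes cont: "continuous_on {0..} g" and K: "g K = K" "0 < K"
    and below: "\<And>y. 0 < y \<Longrightarrow> y < K \<Longrightarrow> y < g y"
    and above: "\<And>y. K < y \<Longrightarrow> 0 < g y \<and> g y < y"
    and bound: "\<And>y. 0 \<le> y \<Longrightarrow> y < K \<Longrightarrow> g y \<le> B"
    and no_overshoot: "\<And>p q. 0 < p \<Longrightarrow> p < K \<Longrightarrow> K < q \<Longrightarrow> g q \<le> p \<Longrightarrow> q \<le> g p \<Longrightarrow> False"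
    and x0: "x 0 > 0" and orb: "\<And>n. x (Suc n) = g (x n)"
  shows "x \<longlonglongrightarrow> K"
proof -
  define M where "M = max K (max B (x 0))"
  have "continuous_on {K..M} g"
    by (rule continuous_on_subset[OF cont]) (use K in auto)
  moreover have "{K..M} \<noteq> {}" by (simp add: M_def)
  ultimately obtain w where w: "w \<in> {K..M}" "\<And>y. y \<in> {K..M} \<Longrightarrow> g w \<le> g y"
    using continuous_attains_inf[of "{K..M}" g] by auto
  have gw: "0 < g w"
    using w(1) above[of w] K by (cases "w = K") auto
  define c where "c = min (x 0) (g w)"
  have c: "0 < c" using gw x0 by (simp add: c_def)
  have invariant: "g y \<in> {c..M}" if "y \<in> {c..M}" for y
  proof (cases "y < K")
    case True
    then have "y < g y" "g y \<le> B"
      using that c below bound by auto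
    then show ?thesis using that by (auto simp: M_def)
  next
    case False
    then have "g w \<le> g y" using w(2) that by simp
    moreover have "g y \<le> y" using False above[of y] K by (cases "y = K") auto
    ultimately show ?thesis using that by (auto simp: c_def)
  qed
  have "x n \<in> {c..M}" for n
  proof (induction n)
    case 0
    then show ?case by (simp add: c_def M_def)
  next
    case (Suc n)
    then show ?case unfolding orb by (rule invariant)
  qed
  moreover have "continuous_on {c..M} g"
    by (rule continuous_on_subset[OF cont]) (use c in auto)
  ultimately obtain l u p q where lu: "c \<le> l" "u \<le> M" "p \<in> {l..u}" "q \<in> {l..u}"
      "g p = u" "g q = l" and lim: "\<And>z. l = z \<Longrightarrow> u = z \<Longrightarrow> x \<longlonglongrightarrow> z"
    using orb bounded_orbit_extreme_limits[of c M g x] by blast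
  have pos: "0 < l" "0 < p" "0 < q" using c lu by auto
  have p_below: "p < K" if "K < u"
    using that lu above[of p] K by (cases p K rule: linorder_cases) auto
  have q_above: "K < q" if "l < K"
    using that lu pos below[of q] K by (cases q K rule: linorder_cases) auto
  have "\<not> (l < K \<and> K < u)"
    using no_overshoot[of p q] p_below q_above lu pos by auto
  then have "l = K" "u = K"
    using p_below q_above lu by fastforce+
  then show ?thesis by (rule lim)
qed

theorem proposition2:
  fixes f :: "real \<Rightarrow> real" and K \<alpha>0 \<alpha> :: real and m :: nat
    and a b Lm Lp x :: "nat \<Rightarrow> real"
  assumes B: "assumption_B f K"
    and m: "m \<ge> 1"
    and a_0: "a 0 = K" and a_m: "a m = x_max f K"
    and a_dec: "\<And>i. i < m \<Longrightarrow> a (Suc i) < a i"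
    and L_pos: "\<And>i. i < m \<Longrightarrow> Lm i > 0 \<and> Lp i > 0"
    and L0: "Lm 0 * Lp 0 > 1"
    and \<alpha>0_eq: "\<alpha>0 = alpha_crit (Lm 0) (Lp 0)"
    and slope_pos: "\<And>i. i < m \<Longrightarrow> scaled_slope (Lm i) \<alpha>0 > 0"
    and b_eq: "b = b_seq K \<alpha>0 Lm a"
    and left_0: "\<And>y. a 1 \<le> y \<Longrightarrow> y \<le> K \<Longrightarrow> f y - K \<le> Lm 0 * (K - y)"
    and right_0: "\<And>y. y > K \<Longrightarrow> K - f y \<le> Lp 0 * (y - K)"
    and left: "\<And>i y. i \<in> {1..<m} \<Longrightarrow> a (Suc i) \<le> y \<Longrightarrow> y \<le> a i \<Longrightarrow>
                 f y - f (a i) \<le> Lm i * (a i - y)"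
    and right: "\<And>i y. i \<in> {1..<m} \<Longrightarrow> y \<ge> b i \<Longrightarrow> f (b i) - f y \<le> Lp i * (y - b i)"
    and \<alpha>0_ge: "\<And>i. i \<in> {1..<m} \<Longrightarrow> \<alpha>0 \<ge> alpha_crit (Lm i) (Lp i)"
    and \<alpha>: "\<alpha> \<in> {\<alpha>0<..<1}"
    and x_0: "x 0 > 0"
    and x_Suc: "\<And>n. x (Suc n) = (1 - \<alpha>) * f (x n) + \<alpha> * x n"
  shows "x \<longlonglongrightarrow> K"
proof -
  define g where "g = averaged \<alpha> f"
  define h where "h = averaged \<alpha>0 f"
  define s where "s i = scaled_slope (Lm i) \<alpha>0" for i
  define t where "t i = scaled_slope (Lp i) \<alpha>0" for i
  have A: "assumption_A f K"
    using B unfolding assumption_B_def by blast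
  then have f_cont: "continuous_on {0..} f" and K: "0 < K" "f K = K"
    and f_below: "\<And>y. 0 < y \<Longrightarrow> y < K \<Longrightarrow> y < f y"
    and f_above: "\<And>y. K < y \<Longrightarrow> 0 < f y \<and> f y < y"
    and f0: "f 0 = 0"
    unfolding assumption_A_def by auto
  have m_pos: "0 < m" using m by simp
  have "0 < \<alpha>0"
    unfolding \<alpha>0_eq alpha_crit_def using L0 L_pos[OF m_pos] by simp
  then have \<alpha>0: "\<alpha>0 < \<alpha>" "0 < \<alpha>0" and \<alpha>_range: "0 < \<alpha>" "\<alpha> < 1"
    using \<alpha> by auto
  have b_0: "b 0 = K" and b_Suc: "b (Suc i) = s i * (a i - a (Suc i)) + b i" for i
    by (simp_all add: b_eq s_def)
  have K_fixed: "g K = K" "h K = K"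
    by (simp_all add: g_def h_def averaged_def K algebra_simps)

  have s_pos: "0 < s i" if "i < m" for i
    using slope_pos[OF that] by (simp add: s_def)
  have st: "s i * t i \<le> 1" if "i < m" for i
  proof -
    have "alpha_crit (Lm i) (Lp i) \<le> \<alpha>0"
      using \<alpha>0_eq \<alpha>0_ge[of i] that by (cases "i = 0") auto
    then show ?thesis
      unfolding s_def t_def using L_pos[OF that] slope_pos[OF that]
      by (intro scaled_slope_product_le_1) auto
  qed
  have h_left: "h y - h (a i) \<le> s i * (a i - y)" if "i < m" "a (Suc i) \<le> y" "y \<le> a i" for i y
  proof -
    have "f y - f (a i) \<le> Lm i * (a i - y)"
      using that left_0[of y] left[of i y] a_0 K by (cases "i = 0") auto
    then show ?thesis
      unfolding h_def s_def using \<alpha>0 \<alpha>_range by (intro averaged_slope) auto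
  qed
  have h_right: "h (b i) - h y \<le> t i * (y - b i)" if "i < m" "b i \<le> y" for i y
  proof -
    have "f (b i) - f y \<le> Lp i * (y - b i)"
    proof (cases "i = 0")
      case True
      then show ?thesis
        using that right_0[of y] b_0 K by (cases "y = K") auto
    next
      case False
      then show ?thesis using that right[of i y] by simp
    qed
    then show ?thesis
      unfolding h_def t_def using \<alpha>0 \<alpha>_range by (intro averaged_slope) auto
  qed
  have start: "h (a 0) \<le> b 0" "a 0 \<le> h (b 0)"
    using K_fixed a_0 b_0 by simp_all
  interpret polygonal_barrier a b s t h m
    by unfold_locales (rule a_dec s_pos st b_Suc h_left h_right start; assumption?)+

  have am: "0 \<le> a m" "a m < K"
  proof -
    show "0 \<le> a m"
      using x_max_attains(1)[OF A] a_m by simp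
    have "a n < a 0" if "0 < n" "n \<le> m" for n
      using that
    proof (induction n)
      case (Suc n)
      then show ?case using a_dec[of n] by (cases "n = 0") auto
    qed simp
    then show "a m < K"
      using m_pos a_0 by simp
  qed
  have f_le: "f y \<le> f (a m)" if "0 \<le> y" "y \<le> K" for y
    using x_max_attains(2,3)[OF A] that a_m by simp
  have h_bound: "h y \<le> b m" if "0 \<le> y" "y < K" for y
  proof (cases "a m \<le> y")
    case True
    then show ?thesis using h_le_last_b that a_0 by simp
  next
    \<comment> \<open>Left of the maximizer both summands of the averaged map are at most those at \<open>a m\<close>.\<close>
    case False
    then have "(1 - \<alpha>0) * f y \<le> (1 - \<alpha>0) * f (a m)" "\<alpha>0 * y \<le> \<alpha>0 * a m"
      using f_le that \<alpha>0 \<alpha>_range by (auto intro!: mult_left_mono)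
    then have "h y \<le> h (a m)" unfolding h_def averaged_def by simp
    also have "\<dots> \<le> b m" using h_le_last_b[of "a m"] am a_0 by simp
    finally show ?thesis .
  qed
  have g_less_h: "g y < h y" if "0 < y" "y < K" for y
    using f_below[OF that] averaged_less_iff(1)[OF \<alpha>0(1)] by (simp add: g_def h_def)
  have h_less_g: "h y < g y" if "K < y" for y
    using f_above[OF that] averaged_less_iff(2)[OF \<alpha>0(1)] by (simp add: g_def h_def)
  \<comment> \<open>Weight 1 is the identity, so comparison with it gives the direction in which \<open>g\<close> moves points.\<close>
  have identity: "averaged 1 f y = y" for y
    by (simp add: averaged_def)

  show ?thesis
  proof (rule converges_if_no_overshoot[of g])
    show "continuous_on {0..} g"
      unfolding g_def averaged_def by (intro continuous_intros f_cont)
    show "g K = K" "0 < K" by fact+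
    show "y < g y" if "0 < y" "y < K" for y
      using averaged_less_iff(1)[OF \<alpha>_range(2), of f y] f_below[OF that]
      by (simp add: identity g_def)
    show "0 < g y \<and> g y < y" if "K < y" for y
    proof
      show "0 < g y"
        unfolding g_def averaged_def using f_above[OF that] \<alpha>_range K(1) that
        by (intro add_pos_pos mult_pos_pos) auto
      show "g y < y"
        using averaged_less_iff(2)[OF \<alpha>_range(2), of f y] f_above[OF that]
        by (simp add: identity g_def)
    qed
    show bound: "g y \<le> b m" if "0 \<le> y" "y < K" for y
    proof (cases "y = 0")
      case True
      then have "g y = h y" by (simp add: g_def h_def averaged_def f0)
      then show ?thesis using h_bound[OF that] by simp
    next
      case False
      then show ?thesis using g_less_h[of y] h_bound[OF that] that by simp
    qed
    show False if "0 < p" "p < K" "K < q" "g q \<le> p" "q \<le> g p" for p q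
    proof -
      have "h q < p" using h_less_g[of q] that by simp
      moreover have "q \<le> b m" using bound[of p] that by simp
      ultimately have "h p \<le> q"
        using staircase_no_overshoot[of p q] that a_0 b_0 by simp
      then show False using g_less_h[of p] that by simp
    qed
    show "0 < x 0" by fact
    show "x (Suc n) = g (x n)" for n
      by (simp add: x_Suc g_def averaged_def)
  qed
qed

end
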